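(* Let $(\varphi_i)_{i\in\mathbb{N}}\subset H^s_0$ be linearly independent, let $\Phi^N=\mathrm{span}\{\varphi_i\}_{i=1}^N$, and assume that $\Phi^N$ becomes dense in $H^s_0$ as $N\to\infty$, i.e. $\overline{\bigcup_N\Phi^N}=H^s_0$. Then for all $f\in H^{-s}$, $$\lim_{N\to\infty}|f|_{\Phi^N}=\|f\|_{H^{-s}}.$$
   Context: $\Omega\subset\mathbb{R}^d$ is a bounded open domain with Lipschitz boundary, $s>0$, and all function spaces are over $\Omega$. $H^s_0$ is the closure in the Sobolev space $H^s$ of the smooth compactly supported functions, equipped with the norm (equivalent to the $H^s$ norm) $\|u\|_{H^s_0}^2=\int u(-\Delta)^su$, where $\Delta$ is the Laplacian with homogeneous Dirichlet boundary conditions and fractional powers are defined spectrally. $H^{-s}$ is the dual of $H^s_0$ with respect to the $L^2$ duality, with norm $\|f\|_{H^{-s}}=\sup_{0\ne u\in H^s_0}\frac{\int fu}{\|u\|_{H^s_0}}$ (where $\int fu$ denotes the duality pairing). For $f\in H^{-s}$, $|f|_{\Phi^N}:=\sup_{0\ne u\in\Phi^N}\frac{\int fu}{\|u\|_{H^s_0}}$. *)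

theory Defs
  imports "HOL-Analysis.Analysis"
begin

section \<open>Lipschitz domains\<close>

text \<open>Near each boundary point, after a rotation, the set is the part of a ball lying above the
  graph of a Lipschitz function: \<open>n\<close> is the unit vector of the last rotated coordinate and \<open>\<gamma>\<close> is a
  function on the hyperplane orthogonal to it.\<close>

definition lipschitz_boundary :: "(real^'n) set \<Rightarrow> bool" where
  "lipschitz_boundary \<Omega> \<longleftrightarrow>
     (\<forall>x\<in>frontier \<Omega>. \<exists>r>0. \<exists>n L \<gamma>. norm n = 1 \<and> L-lipschitz_on {z. z \<bullet> n = 0} \<gamma> \<and>
        \<Omega> \<inter> ball x r = {y \<in> ball x r. y \<bullet> n > \<gamma> (y - (y \<bullet> n) *\<^sub>R n)})"

definition lipschitz_domain :: "(real^'n) set \<Rightarrow> bool" where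
  "lipschitz_domain \<Omega> \<longleftrightarrow>
     open \<Omega> \<and> connected \<Omega> \<and> \<Omega> \<noteq> {} \<and> bounded \<Omega> \<and> lipschitz_boundary \<Omega>"

section \<open>Sobolev spaces\<close>

text \<open>Elements of the function spaces are represented by functions on the whole space, of which
  only the values on \<open>\<Omega>\<close>, up to null sets, are relevant.\<close>

definition ae_zero :: "(real^'n) set \<Rightarrow> (real^'n \<Rightarrow> real) \<Rightarrow> bool" where
  "ae_zero \<Omega> u \<longleftrightarrow> (AE x in lebesgue_on \<Omega>. u x = 0)"

definition L2 :: "(real^'n) set \<Rightarrow> (real^'n \<Rightarrow> real) set" where
  "L2 \<Omega> = {u \<in> borel_measurable (lebesgue_on \<Omega>). integrable (lebesgue_on \<Omega>) (\<lambda>x. (u x)\<^sup>2)}"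

definition L2_inner :: "(real^'n) set \<Rightarrow> (real^'n \<Rightarrow> real) \<Rightarrow> (real^'n \<Rightarrow> real) \<Rightarrow> real" where
  "L2_inner \<Omega> u v = (LINT x|lebesgue_on \<Omega>. u x * v x)"

definition pderivative :: "'n \<Rightarrow> (real^'n \<Rightarrow> real) \<Rightarrow> (real^'n \<Rightarrow> real)" where
  "pderivative i f = (\<lambda>x. frechet_derivative f (at x) (axis i 1))"

text \<open>Derivatives of order \<open>k\<close> are indexed by lists of \<open>k\<close> coordinates.\<close>

definition iter_pderivative :: "'n list \<Rightarrow> (real^'n \<Rightarrow> real) \<Rightarrow> (real^'n \<Rightarrow> real)" where
  "iter_pderivative is f = foldr pderivative is f"

definition smooth_fun :: "(real^'n \<Rightarrow> real) \<Rightarrow> bool" where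
  "smooth_fun f \<longleftrightarrow> (\<forall>is x. iter_pderivative is f differentiable (at x))"

definition test_funs :: "(real^'n) set \<Rightarrow> (real^'n \<Rightarrow> real) set" where
  "test_funs \<Omega> =
     {\<psi>. smooth_fun \<psi> \<and> compact (closure {x. \<psi> x \<noteq> 0}) \<and> closure {x. \<psi> x \<noteq> 0} \<subseteq> \<Omega>}"

definition has_weak_derivative ::
  "(real^'n) set \<Rightarrow> 'n list \<Rightarrow> (real^'n \<Rightarrow> real) \<Rightarrow> (real^'n \<Rightarrow> real) \<Rightarrow> bool" where
  "has_weak_derivative \<Omega> is u g \<longleftrightarrow> u \<in> L2 \<Omega> \<and> g \<in> L2 \<Omega> \<and>
     (\<forall>\<psi>\<in>test_funs \<Omega>. L2_inner \<Omega> u (iter_pderivative is \<psi>) = (-1) ^ length is * L2_inner \<Omega> g \<psi>)"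

text \<open>All weak derivatives of order at most \<open>m\<close>.\<close>

definition weak_jets ::
  "nat \<Rightarrow> (real^'n) set \<Rightarrow> (real^'n \<Rightarrow> real) \<Rightarrow> ('n list \<Rightarrow> real^'n \<Rightarrow> real) set" where
  "weak_jets m \<Omega> u = {G. \<forall>is. length is \<le> m \<longrightarrow> has_weak_derivative \<Omega> is u (G is)}"

definition gagliardo_sq :: "real \<Rightarrow> (real^'n) set \<Rightarrow> (real^'n \<Rightarrow> real) \<Rightarrow> ennreal" where
  "gagliardo_sq \<sigma> \<Omega> g =
     (\<integral>\<^sup>+x. (\<integral>\<^sup>+y. ennreal ((g x - g y)\<^sup>2 / dist x y powr (real CARD('n) + 2 * \<sigma>))
        \<partial>lebesgue_on \<Omega>) \<partial>lebesgue_on \<Omega>)"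

text \<open>The square of the Sobolev-Slobodeckij norm of \<open>H^s\<close> with \<open>s = m + \<sigma>\<close>, \<open>0 \<le> \<sigma> < 1\<close>.
  Weak derivatives are unique up to null sets, so all members of \<open>weak_jets m \<Omega> u\<close> give the same
  value; the infimum picks it, and it is \<open>\<infinity>\<close> if some weak derivative does not exist in \<open>L\<^sup>2\<close>.
  Summing over lists instead of multi-indices only puts multinomial weights on the terms.\<close>

definition sobolev_norm_sq :: "real \<Rightarrow> (real^'n) set \<Rightarrow> (real^'n \<Rightarrow> real) \<Rightarrow> ennreal" where
  "sobolev_norm_sq s \<Omega> u =
     (let m = nat \<lfloor>s\<rfloor>; \<sigma> = frac s in
      INF G\<in>weak_jets m \<Omega> u.
        (\<Sum>is | length is \<le> m. \<integral>\<^sup>+x. ennreal ((G is x)\<^sup>2) \<partial>lebesgue_on \<Omega>) +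
        (if \<sigma> = 0 then 0 else (\<Sum>is | length is = m. gagliardo_sq \<sigma> \<Omega> (G is))))"

definition Hs :: "real \<Rightarrow> (real^'n) set \<Rightarrow> (real^'n \<Rightarrow> real) set" where
  "Hs s \<Omega> = {u. sobolev_norm_sq s \<Omega> u < \<infinity>}"

definition Hs0 :: "real \<Rightarrow> (real^'n) set \<Rightarrow> (real^'n \<Rightarrow> real) set" where
  "Hs0 s \<Omega> = {u \<in> Hs s \<Omega>. \<forall>\<epsilon>>0. \<exists>\<psi>\<in>test_funs \<Omega>.
                 sobolev_norm_sq s \<Omega> (\<lambda>x. u x - \<psi> x) < ennreal (\<epsilon>\<^sup>2)}"

section \<open>Spectral fractional powers of the Dirichlet Laplacian\<close>

text \<open>\<open>w \<in> H\<^sup>1\<^sub>0\<close> and \<open>- \<Delta> w = \<mu> w\<close> in the sense of distributions.\<close>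

definition dirichlet_eigenfunction :: "(real^'n) set \<Rightarrow> real \<Rightarrow> (real^'n \<Rightarrow> real) \<Rightarrow> bool" where
  "dirichlet_eigenfunction \<Omega> \<mu> w \<longleftrightarrow> w \<in> Hs0 1 \<Omega> \<and>
     (\<forall>\<psi>\<in>test_funs \<Omega>.
        - L2_inner \<Omega> w (\<lambda>x. \<Sum>i\<in>UNIV. iter_pderivative [i, i] \<psi> x) = \<mu> * L2_inner \<Omega> w \<psi>)"

definition dirichlet_eigenbasis ::
  "(real^'n) set \<Rightarrow> (nat \<Rightarrow> real) \<times> (nat \<Rightarrow> real^'n \<Rightarrow> real) \<Rightarrow> bool" where
  "dirichlet_eigenbasis \<Omega> = (\<lambda>(\<mu>, e).
     (\<forall>k. dirichlet_eigenfunction \<Omega> (\<mu> k) (e k)) \<and>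
     (\<forall>j k. L2_inner \<Omega> (e j) (e k) = (if j = k then 1 else 0)) \<and>
     (\<forall>u\<in>L2 \<Omega>. (\<lambda>n. LINT x|lebesgue_on \<Omega>. (u x - (\<Sum>k<n. L2_inner \<Omega> u (e k) * e k x))\<^sup>2)
                  \<longlonglongrightarrow> 0))"

text \<open>A fixed \<open>L\<^sup>2\<close>-orthonormal basis of Dirichlet eigenfunctions with its eigenvalues. It exists for
  every bounded nonempty open set by the spectral theorem, so the zero alternative only makes the
  definition total; the fractional powers below do not depend on the choice.\<close>

definition dirichlet_spectrum ::
  "(real^'n) set \<Rightarrow> (nat \<Rightarrow> real) \<times> (nat \<Rightarrow> real^'n \<Rightarrow> real)" where
  "dirichlet_spectrum \<Omega> =
     (if \<exists>p. dirichlet_eigenbasis \<Omega> p then SOME p. dirichlet_eigenbasis \<Omega> p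
      else (\<lambda>k. 0, \<lambda>k x. 0))"

definition eigval :: "(real^'n) set \<Rightarrow> nat \<Rightarrow> real" where
  "eigval \<Omega> = fst (dirichlet_spectrum \<Omega>)"

definition eigfun :: "(real^'n) set \<Rightarrow> nat \<Rightarrow> real^'n \<Rightarrow> real" where
  "eigfun \<Omega> = snd (dirichlet_spectrum \<Omega>)"

text \<open>The \<open>k\<close>-th coefficient of \<open>(-\<Delta>)^s u\<close> in the eigenbasis.\<close>

definition frac_laplacian_coeff :: "real \<Rightarrow> (real^'n) set \<Rightarrow> (real^'n \<Rightarrow> real) \<Rightarrow> nat \<Rightarrow> real" where
  "frac_laplacian_coeff s \<Omega> u k = eigval \<Omega> k powr s * L2_inner \<Omega> u (eigfun \<Omega> k)"

text \<open>The pairing \<open>\<integral> u (-\<Delta>)^s u\<close>, computed in the eigenbasis because \<open>(-\<Delta>)^s u\<close> is in general not a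
  function. All terms are nonnegative.\<close>

definition frac_energy :: "real \<Rightarrow> (real^'n) set \<Rightarrow> (real^'n \<Rightarrow> real) \<Rightarrow> ennreal" where
  "frac_energy s \<Omega> u =
     (\<Sum>k. ennreal (L2_inner \<Omega> u (eigfun \<Omega> k) * frac_laplacian_coeff s \<Omega> u k))"

text \<open>The norm is extended-valued so that nothing has to be assumed about its equivalence with the
  \<open>H^s\<close> norm on \<open>H\<^sup>s\<^sub>0\<close>. Where the two are equivalent, it is finite on \<open>H\<^sup>s\<^sub>0\<close>; for exceptional
  exponents such as \<open>s = 1/2\<close> it may take the value \<open>\<infinity>\<close> there.\<close>

definition Hs0_norm :: "real \<Rightarrow> (real^'n) set \<Rightarrow> (real^'n \<Rightarrow> real) \<Rightarrow> ereal" where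
  "Hs0_norm s \<Omega> u =
     (if frac_energy s \<Omega> u = \<infinity> then \<infinity> else ereal (sqrt (enn2real (frac_energy s \<Omega> u))))"

definition Hs0_closure ::
  "real \<Rightarrow> (real^'n) set \<Rightarrow> (real^'n \<Rightarrow> real) set \<Rightarrow> (real^'n \<Rightarrow> real) set" where
  "Hs0_closure s \<Omega> V =
     {u \<in> Hs0 s \<Omega>. \<forall>\<epsilon>>0. \<exists>v\<in>V. Hs0_norm s \<Omega> (\<lambda>x. u x - v x) < ereal \<epsilon>}"

section \<open>The dual space\<close>

text \<open>\<open>H\<^sup>-\<^sup>s\<close> consists of the bounded linear functionals on \<open>H\<^sup>s\<^sub>0\<close>; the value \<open>f u\<close> is the duality
  pairing \<open>\<integral> f u\<close>. By boundedness it depends only on the class of \<open>u\<close> modulo null sets.\<close>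

definition Hs_dual :: "real \<Rightarrow> (real^'n) set \<Rightarrow> ((real^'n \<Rightarrow> real) \<Rightarrow> real) set" where
  "Hs_dual s \<Omega> =
     {f. (\<forall>u\<in>Hs0 s \<Omega>. \<forall>v\<in>Hs0 s \<Omega>. \<forall>a b. f (\<lambda>x. a * u x + b * v x) = a * f u + b * f v) \<and>
         (\<exists>C::real. C \<ge> 0 \<and> (\<forall>u\<in>Hs0 s \<Omega>. ereal \<bar>f u\<bar> \<le> ereal C * Hs0_norm s \<Omega> u))}"

text \<open>\<open>|f|\<^sub>V\<close> for a set \<open>V\<close> of functions in \<open>H\<^sup>s\<^sub>0\<close>.\<close>

definition dual_seminorm ::
  "real \<Rightarrow> (real^'n) set \<Rightarrow> (real^'n \<Rightarrow> real) set \<Rightarrow> ((real^'n \<Rightarrow> real) \<Rightarrow> real) \<Rightarrow> ereal" where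
  "dual_seminorm s \<Omega> V f = (SUP u\<in>{u \<in> V. \<not> ae_zero \<Omega> u}. ereal (f u) / Hs0_norm s \<Omega> u)"

definition Hs_dual_norm :: "real \<Rightarrow> (real^'n) set \<Rightarrow> ((real^'n \<Rightarrow> real) \<Rightarrow> real) \<Rightarrow> ereal" where
  "Hs_dual_norm s \<Omega> f = dual_seminorm s \<Omega> (Hs0 s \<Omega>) f"

section \<open>Finite-dimensional subspaces\<close>

definition fun_span :: "(nat \<Rightarrow> real^'n \<Rightarrow> real) \<Rightarrow> nat \<Rightarrow> (real^'n \<Rightarrow> real) set" where
  "fun_span \<phi> N = {\<lambda>x. \<Sum>i=1..N. c i * \<phi> i x | c. True}"

text \<open>Linear independence of \<open>\<phi>\<^sub>1, \<phi>\<^sub>2, \<dots>\<close> modulo null sets; \<open>\<phi> 0\<close> is not used.\<close>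

definition lin_indep :: "(real^'n) set \<Rightarrow> (nat \<Rightarrow> real^'n \<Rightarrow> real) \<Rightarrow> bool" where
  "lin_indep \<Omega> \<phi> \<longleftrightarrow>
     (\<forall>N c. ae_zero \<Omega> (\<lambda>x. \<Sum>i=1..N. c i * \<phi> i x) \<longrightarrow> (\<forall>i\<in>{1..N}. c i = 0))"

end

theory Submission
  imports Defs
begin

text \<open>The seminorms increase with \<open>N\<close>, so the limit is the supremum \<open>K\<close> of \<open>f v / \<parallel>v\<parallel>\<close> over the
  union \<open>V\<close> of the spans, and \<open>K \<ge> 0\<close> because \<open>V\<close> is symmetric. If \<open>0 < \<parallel>u\<parallel> < \<infinity>\<close> and \<open>v \<in> V\<close>
  satisfies \<open>\<parallel>u - v\<parallel> < \<epsilon>\<close>, then \<open>f u \<le> f v + C \<epsilon> \<le> K (\<parallel>u\<parallel> + \<epsilon>) + C \<epsilon>\<close>, and \<open>\<epsilon> \<rightarrow> 0\<close> gives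
  \<open>f u / \<parallel>u\<parallel> \<le> K\<close>. If \<open>\<parallel>u\<parallel> = 0\<close> then \<open>f u = 0\<close>, and if \<open>\<parallel>u\<parallel> = \<infinity>\<close> the quotient is \<open>0\<close> by
  convention.\<close>

section \<open>Linear combinations in the function spaces\<close>

text \<open>The cross term is absorbed by a square. The factor 2 is harmless: the Sobolev norm only
  decides membership and approximability, where constants do not matter.\<close>

lemma lincomb_square_le:
  fixes a b x y :: real
  shows "(a * x + b * y)\<^sup>2 \<le> 2 * a\<^sup>2 * x\<^sup>2 + 2 * b\<^sup>2 * y\<^sup>2"
proof -
  have "0 \<le> (a * x - b * y)\<^sup>2" by simp
  then show ?thesis by (simp add: power2_eq_square algebra_simps)
qed

section \<open>Square-integrable functions\<close>

lemma L2_mult_integrable: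
  assumes "u \<in> L2 \<Omega>" "v \<in> L2 \<Omega>"
  shows "integrable (lebesgue_on \<Omega>) (\<lambda>x. u x * v x)"
proof (rule Bochner_Integration.integrable_bound)
  show "integrable (lebesgue_on \<Omega>) (\<lambda>x. (u x)\<^sup>2 + (v x)\<^sup>2)"
    using assms by (auto simp: L2_def)
  show "(\<lambda>x. u x * v x) \<in> borel_measurable (lebesgue_on \<Omega>)"
    using assms by (auto simp: L2_def)
  show "AE x in lebesgue_on \<Omega>. norm (u x * v x) \<le> norm ((u x)\<^sup>2 + (v x)\<^sup>2)"
  proof (rule AE_I2)
    fix x
    have "0 \<le> (\<bar>u x\<bar> - \<bar>v x\<bar>)\<^sup>2" by simp
    then have "2 * (\<bar>u x\<bar> * \<bar>v x\<bar>) \<le> (u x)\<^sup>2 + (v x)\<^sup>2"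
      by (simp add: power2_diff)
    moreover have "0 \<le> \<bar>u x\<bar> * \<bar>v x\<bar>" by simp
    ultimately have "\<bar>u x\<bar> * \<bar>v x\<bar> \<le> (u x)\<^sup>2 + (v x)\<^sup>2" by linarith
    then show "norm (u x * v x) \<le> norm ((u x)\<^sup>2 + (v x)\<^sup>2)" by (simp add: abs_mult)
  qed
qed

lemma L2_lincomb:
  assumes "u \<in> L2 \<Omega>" "v \<in> L2 \<Omega>"
  shows "(\<lambda>x. a * u x + b * v x) \<in> L2 \<Omega>"
proof -
  have "(\<lambda>x. a * u x + b * v x) \<in> borel_measurable (lebesgue_on \<Omega>)"
    using assms by (auto simp: L2_def)
  moreover have "integrable (lebesgue_on \<Omega>)
      (\<lambda>x. a\<^sup>2 * (u x * u x) + (2 * a * b) * (u x * v x) + b\<^sup>2 * (v x * v x))"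
    using assms by (intro Bochner_Integration.integrable_add integrable_mult_right L2_mult_integrable)
  then have "integrable (lebesgue_on \<Omega>) (\<lambda>x. (a * u x + b * v x)\<^sup>2)"
    by (rule back_subst[where P="integrable _"]) (auto simp: power2_eq_square algebra_simps)
  ultimately show ?thesis by (simp add: L2_def)
qed

lemma L2_inner_lincomb:
  assumes "u \<in> L2 \<Omega>" "v \<in> L2 \<Omega>" "w \<in> L2 \<Omega>"
  shows "L2_inner \<Omega> (\<lambda>x. a * u x + b * v x) w = a * L2_inner \<Omega> u w + b * L2_inner \<Omega> v w"
proof -
  have "L2_inner \<Omega> (\<lambda>x. a * u x + b * v x) w
      = (LINT x|lebesgue_on \<Omega>. a * (u x * w x) + b * (v x * w x))"
    unfolding L2_inner_def by (rule arg_cong[where f="integral\<^sup>L _"]) (auto simp: algebra_simps)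
  also have "\<dots> = a * L2_inner \<Omega> u w + b * L2_inner \<Omega> v w"
    unfolding L2_inner_def using assms by (simp add: L2_mult_integrable)
  finally show ?thesis .
qed

text \<open>Continuity bounds \<open>g\<close> on the compact closure of \<open>\<Omega>\<close>,
  which has finite measure. The intended \<open>g\<close> are the derivatives of test
  functions.\<close>

lemma L2_continuous:
  assumes "open \<Omega>" "bounded \<Omega>" "continuous_on UNIV g"
  shows "g \<in> L2 \<Omega>"
proof -
  have meas: "g \<in> borel_measurable (lebesgue_on \<Omega>)"
    using assms by (intro continuous_imp_measurable_on_sets_lebesgue)
      (auto intro: continuous_on_subset)
  have "compact (g ` closure \<Omega>)"
    using assms by (intro compact_continuous_image) (auto intro: continuous_on_subset)
  then obtain B where B: "\<And>x. x \<in> \<Omega> \<Longrightarrow> norm (g x) \<le> B"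
    by (metis bounded_iff closure_subset compact_imp_bounded imageI subsetD)
  have fin: "emeasure (lebesgue_on \<Omega>) \<Omega> < \<infinity>"
    using assms bounded_set_imp_lmeasurable[of \<Omega>]
    by (auto simp: fmeasurable_def emeasure_restrict_space)
  have "integrable (lebesgue_on \<Omega>) (\<lambda>x. (g x)\<^sup>2)"
  proof (rule integrableI_bounded_set[where A=\<Omega> and B="B\<^sup>2"])
    show "\<Omega> \<in> sets (lebesgue_on \<Omega>)"
      using assms by (metis sets.top space_lebesgue_on)
    show "AE x in lebesgue_on \<Omega>. x \<in> \<Omega> \<longrightarrow> norm ((g x)\<^sup>2) \<le> B\<^sup>2"
      using B by (intro AE_I2) (auto simp: abs_le_square_iff[symmetric] intro: order_trans[OF _ abs_ge_self])
    show "AE x in lebesgue_on \<Omega>. x \<notin> \<Omega> \<longrightarrow> (g x)\<^sup>2 = 0"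
      by (intro AE_I2) auto
  qed (use meas fin in auto)
  then show ?thesis using meas by (simp add: L2_def)
qed

section \<open>Test functions and weak derivatives\<close>

text \<open>\<open>frechet_derivative\<close> is a choice operator, so linearity is available only
  at points of differentiability; smoothness supplies these at every stage of the induction.\<close>

lemma iter_pderivative_lincomb:
  assumes "smooth_fun f" "smooth_fun g"
  shows "iter_pderivative is (\<lambda>x. a * f x + b * g x)
    = (\<lambda>x. a * iter_pderivative is f x + b * iter_pderivative is g x)"
proof (induction "is")
  case Nil
  then show ?case by (simp add: iter_pderivative_def)
next
  case (Cons i js)
  let ?f = "iter_pderivative js f" and ?g = "iter_pderivative js g"
  have "frechet_derivative (\<lambda>y. a * ?f y + b * ?g y) (at x)
      = (\<lambda>h. a * frechet_derivative ?f (at x) h + b * frechet_derivative ?g (at x) h)" for x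
  proof (rule frechet_derivative_at[symmetric])
    have "?f differentiable (at x)" "?g differentiable (at x)"
      using assms by (auto simp: smooth_fun_def)
    then show "((\<lambda>y. a * ?f y + b * ?g y) has_derivative
        (\<lambda>h. a * frechet_derivative ?f (at x) h + b * frechet_derivative ?g (at x) h)) (at x)"
      by (intro has_derivative_add has_derivative_mult_right) (auto simp: frechet_derivative_works)
  qed
  then show ?case
    using Cons by (simp add: iter_pderivative_def pderivative_def)
qed

text \<open>The support of the combination is a closed subset of the union of two compact
  supports.\<close>

lemma test_funs_lincomb:
  assumes "\<psi> \<in> test_funs \<Omega>" "\<xi> \<in> test_funs \<Omega>"
  shows "(\<lambda>x. a * \<psi> x + b * \<xi> x) \<in> test_funs \<Omega>"
proof -
  let ?g = "\<lambda>x. a * \<psi> x + b * \<xi> x"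
  have smooth: "smooth_fun \<psi>" "smooth_fun \<xi>" using assms by (auto simp: test_funs_def)
  then have "smooth_fun ?g"
    by (subst smooth_fun_def, subst iter_pderivative_lincomb) (auto simp: smooth_fun_def)
  moreover have "closure {x. ?g x \<noteq> 0} \<subseteq> closure ({x. \<psi> x \<noteq> 0} \<union> {x. \<xi> x \<noteq> 0})"
    by (rule closure_mono) auto
  then have sub: "closure {x. ?g x \<noteq> 0} \<subseteq> closure {x. \<psi> x \<noteq> 0} \<union> closure {x. \<xi> x \<noteq> 0}"
    by (simp add: closure_Un)
  moreover have "compact (closure {x. \<psi> x \<noteq> 0} \<union> closure {x. \<xi> x \<noteq> 0})"
    using assms by (auto simp: test_funs_def)
  from compact_Int_closed[OF this closed_closure[of "{x. ?g x \<noteq> 0}"]] sub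
  have "compact (closure {x. ?g x \<noteq> 0})"
    by (simp only: Int_absorb1)
  ultimately show ?thesis using assms by (auto simp: test_funs_def)
qed

lemma has_weak_derivative_lincomb:
  assumes "open \<Omega>" "bounded \<Omega>"
    and "has_weak_derivative \<Omega> is u g" "has_weak_derivative \<Omega> is v h"
  shows "has_weak_derivative \<Omega> is (\<lambda>x. a * u x + b * v x) (\<lambda>x. a * g x + b * h x)"
  unfolding has_weak_derivative_def
proof (intro conjI ballI)
  have L2: "u \<in> L2 \<Omega>" "v \<in> L2 \<Omega>" "g \<in> L2 \<Omega>" "h \<in> L2 \<Omega>"
    using assms by (auto simp: has_weak_derivative_def)
  then show "(\<lambda>x. a * u x + b * v x) \<in> L2 \<Omega>" "(\<lambda>x. a * g x + b * h x) \<in> L2 \<Omega>"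
    by (auto intro: L2_lincomb)
  fix \<psi> assume \<psi>: "\<psi> \<in> test_funs \<Omega>"
  \<comment> \<open>The integrals against \<open>\<psi>\<close> and its derivative split over the
    sum once all products are integrable. The empty list yields \<open>\<psi>\<close>
    itself.\<close>
  have "iter_pderivative js \<psi> \<in> L2 \<Omega>" for js
    using \<psi> assms(1,2)
    by (intro L2_continuous)
      (auto simp: test_funs_def smooth_fun_def continuous_on_eq_continuous_at
        intro: differentiable_imp_continuous_within)
  from this[of "is"] this[of "[]"] have "iter_pderivative is \<psi> \<in> L2 \<Omega>" "\<psi> \<in> L2 \<Omega>"
    by (auto simp: iter_pderivative_def)
  then show "L2_inner \<Omega> (\<lambda>x. a * u x + b * v x) (iter_pderivative is \<psi>)
      = (-1) ^ length is * L2_inner \<Omega> (\<lambda>x. a * g x + b * h x) \<psi>"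
    using L2 assms(3,4) \<psi>
    by (simp add: L2_inner_lincomb has_weak_derivative_def algebra_simps)
qed

section \<open>The Sobolev norm of a linear combination\<close>

text \<open>The quantity minimised over \<open>G\<close> in \<open>sobolev_norm_sq\<close>, named so
  that estimates can be made for one jet at a time.\<close>

definition jet_norm_sq :: "real \<Rightarrow> (real^'n) set \<Rightarrow> ('n list \<Rightarrow> real^'n \<Rightarrow> real) \<Rightarrow> ennreal" where
  "jet_norm_sq s \<Omega> G =
     (\<Sum>is | length is \<le> nat \<lfloor>s\<rfloor>. \<integral>\<^sup>+x. ennreal ((G is x)\<^sup>2) \<partial>lebesgue_on \<Omega>) +
     (if frac s = 0 then 0 else (\<Sum>is | length is = nat \<lfloor>s\<rfloor>. gagliardo_sq (frac s) \<Omega> (G is)))"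

text \<open>An infimum is strictly below \<open>c\<close> exactly when some competitor is. Strict
  bounds therefore come with a witness jet, and without jets both sides are false.\<close>

lemma sobolev_norm_sq_less_iff:
  "sobolev_norm_sq s \<Omega> u < c \<longleftrightarrow> (\<exists>G\<in>weak_jets (nat \<lfloor>s\<rfloor>) \<Omega> u. jet_norm_sq s \<Omega> G < c)"
  unfolding sobolev_norm_sq_def jet_norm_sq_def Let_def by (rule INF_less_iff)

text \<open>Serves the L^2 terms with \<open>r = 1\<close> and the Gagliardo terms with the kernel's
  denominator. On the diagonal that denominator is 0, and so are the quotients.\<close>

lemma ennreal_lincomb_square_le:
  "ennreal ((a * x + b * y)\<^sup>2 / r) \<le> ennreal (2 * a\<^sup>2) * ennreal (x\<^sup>2 / r) + ennreal (2 * b\<^sup>2) * ennreal (y\<^sup>2 / r)"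
  if "r \<ge> 0" for a b x y r :: real
proof -
  have "(a * x + b * y)\<^sup>2 / r \<le> (2 * a\<^sup>2) * (x\<^sup>2 / r) + (2 * b\<^sup>2) * (y\<^sup>2 / r)"
    using divide_right_mono[OF lincomb_square_le[of a x b y] that]
    by (simp add: add_divide_distrib)
  then show ?thesis
    using that by (simp flip: ennreal_mult ennreal_plus)
qed

lemma gagliardo_sq_lincomb_le:
  fixes g h :: "real^'n \<Rightarrow> real"
  assumes "\<Omega> \<in> lmeasurable" "g \<in> borel_measurable (lebesgue_on \<Omega>)" "h \<in> borel_measurable (lebesgue_on \<Omega>)"
  shows "gagliardo_sq \<sigma> \<Omega> (\<lambda>x. a * g x + b * h x)
    \<le> ennreal (2 * a\<^sup>2) * gagliardo_sq \<sigma> \<Omega> g + ennreal (2 * b\<^sup>2) * gagliardo_sq \<sigma> \<Omega> h"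
proof -
  let ?M = "lebesgue_on \<Omega>"
  let ?q = "\<lambda>(g::real^'n\<Rightarrow>real) x y. ennreal ((g x - g y)\<^sup>2 / dist x y powr (real CARD('n) + 2 * \<sigma>))"
  \<comment> \<open>Finiteness gives sigma-finiteness, so joint measurability of the kernel makes
    the inner integral measurable in the outer variable and the outer integral additive.\<close>
  interpret finite_measure ?M
    using assms(1) by (rule finite_measure_lebesgue_on)
  have id[measurable]: "(\<lambda>x. x) \<in> ?M \<rightarrow>\<^sub>M borel"
    by (intro continuous_imp_measurable_on_sets_lebesgue fmeasurableD assms(1) continuous_on_id)
  have q[measurable]: "case_prod (?q k) \<in> borel_measurable (?M \<Otimes>\<^sub>M ?M)"
    if [measurable]: "k \<in> borel_measurable ?M" for k
    by measurable
  note [measurable] = assms(2,3)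
  have "gagliardo_sq \<sigma> \<Omega> (\<lambda>x. a * g x + b * h x)
      \<le> (\<integral>\<^sup>+x. (\<integral>\<^sup>+y. ennreal (2 * a\<^sup>2) * ?q g x y + ennreal (2 * b\<^sup>2) * ?q h x y \<partial>?M) \<partial>?M)"
    unfolding gagliardo_sq_def
  proof (intro nn_integral_mono)
    fix x y
    have "a * g x + b * h x - (a * g y + b * h y) = a * (g x - g y) + b * (h x - h y)"
      by (simp add: algebra_simps)
    then show "?q (\<lambda>x. a * g x + b * h x) x y
        \<le> ennreal (2 * a\<^sup>2) * ?q g x y + ennreal (2 * b\<^sup>2) * ?q h x y"
      by (metis ennreal_lincomb_square_le powr_ge_zero)
  qed
  also have "\<dots> = (\<integral>\<^sup>+x. ennreal (2 * a\<^sup>2) * (\<integral>\<^sup>+y. ?q g x y \<partial>?M)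
      + ennreal (2 * b\<^sup>2) * (\<integral>\<^sup>+y. ?q h x y \<partial>?M) \<partial>?M)"
    by (rule nn_integral_cong) (simp add: nn_integral_add nn_integral_cmult)
  also have "\<dots> = ennreal (2 * a\<^sup>2) * gagliardo_sq \<sigma> \<Omega> g + ennreal (2 * b\<^sup>2) * gagliardo_sq \<sigma> \<Omega> h"
    unfolding gagliardo_sq_def by (simp add: nn_integral_add nn_integral_cmult)
  finally show ?thesis .
qed

lemma jet_norm_sq_lincomb_le:
  assumes "\<Omega> \<in> lmeasurable" "G \<in> weak_jets (nat \<lfloor>s\<rfloor>) \<Omega> u" "H \<in> weak_jets (nat \<lfloor>s\<rfloor>) \<Omega> v"
  shows "jet_norm_sq s \<Omega> (\<lambda>is x. a * G is x + b * H is x)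
    \<le> ennreal (2 * a\<^sup>2) * jet_norm_sq s \<Omega> G + ennreal (2 * b\<^sup>2) * jet_norm_sq s \<Omega> H"
proof -
  let ?A = "ennreal (2 * a\<^sup>2)" and ?B = "ennreal (2 * b\<^sup>2)" and ?m = "nat \<lfloor>s\<rfloor>"
  let ?I = "\<lambda>g::real^'a\<Rightarrow>real. \<integral>\<^sup>+x. ennreal ((g x)\<^sup>2) \<partial>lebesgue_on \<Omega>"
  let ?F = "\<lambda>is x. a * G is x + b * H is x"
  have meas: "G is \<in> borel_measurable (lebesgue_on \<Omega>)" "H is \<in> borel_measurable (lebesgue_on \<Omega>)"
    if "length is \<le> ?m" for "is"
    using that assms(2,3) by (auto simp: weak_jets_def has_weak_derivative_def L2_def)
  have 1: "?I (?F is) \<le> ?A * ?I (G is) + ?B * ?I (H is)" if "length is \<le> ?m" for "is"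
  proof -
    note [measurable] = meas[OF that]
    have "?I (?F is) \<le> (\<integral>\<^sup>+x. ?A * ennreal ((G is x)\<^sup>2) + ?B * ennreal ((H is x)\<^sup>2) \<partial>lebesgue_on \<Omega>)"
      using ennreal_lincomb_square_le[of 1] by (intro nn_integral_mono) simp
    also have "\<dots> = ?A * ?I (G is) + ?B * ?I (H is)"
      by (simp add: nn_integral_add nn_integral_cmult)
    finally show ?thesis .
  qed
  have 2: "gagliardo_sq (frac s) \<Omega> (?F is)
      \<le> ?A * gagliardo_sq (frac s) \<Omega> (G is) + ?B * gagliardo_sq (frac s) \<Omega> (H is)"
    if "length is = ?m" for "is"
    using that meas assms(1) by (intro gagliardo_sq_lincomb_le) auto
  have s1: "(\<Sum>is | length is \<le> ?m. ?I (?F is))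
      \<le> ?A * (\<Sum>is | length is \<le> ?m. ?I (G is)) + ?B * (\<Sum>is | length is \<le> ?m. ?I (H is))"
    unfolding sum_distrib_left sum.distrib[symmetric] using 1 by (intro sum_mono) auto
  have s2: "(\<Sum>is | length is = ?m. gagliardo_sq (frac s) \<Omega> (?F is))
      \<le> ?A * (\<Sum>is | length is = ?m. gagliardo_sq (frac s) \<Omega> (G is))
       + ?B * (\<Sum>is | length is = ?m. gagliardo_sq (frac s) \<Omega> (H is))"
    unfolding sum_distrib_left sum.distrib[symmetric] using 2 by (intro sum_mono) auto
  show ?thesis
    unfolding jet_norm_sq_def using s1 add_mono[OF s1 s2]
    by (auto simp: distrib_left algebra_simps)
qed

text \<open>The slack \<open>\<eta>\<close> keeps the inequality strict when
  \<open>a = b = 0\<close>.\<close>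

lemma sobolev_norm_sq_lincomb_less:
  assumes "open \<Omega>" "bounded \<Omega>" "0 < c" "0 < d" "0 < \<eta>"
    and "sobolev_norm_sq s \<Omega> u < ennreal c" "sobolev_norm_sq s \<Omega> v < ennreal d"
  shows "sobolev_norm_sq s \<Omega> (\<lambda>x. a * u x + b * v x) < ennreal (2 * a\<^sup>2 * c + 2 * b\<^sup>2 * d + \<eta>)"
  proof -
  obtain G H where G: "G \<in> weak_jets (nat \<lfloor>s\<rfloor>) \<Omega> u" "jet_norm_sq s \<Omega> G < ennreal c"
    and H: "H \<in> weak_jets (nat \<lfloor>s\<rfloor>) \<Omega> v" "jet_norm_sq s \<Omega> H < ennreal d"
    using assms by (auto simp: sobolev_norm_sq_less_iff)
  have "(\<lambda>is x. a * G is x + b * H is x) \<in> weak_jets (nat \<lfloor>s\<rfloor>) \<Omega> (\<lambda>x. a * u x + b * v x)"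
    using G(1) H(1) assms(1,2) by (auto simp: weak_jets_def intro: has_weak_derivative_lincomb)
  moreover have "jet_norm_sq s \<Omega> (\<lambda>is x. a * G is x + b * H is x)
      \<le> ennreal (2 * a\<^sup>2) * jet_norm_sq s \<Omega> G + ennreal (2 * b\<^sup>2) * jet_norm_sq s \<Omega> H"
    using lmeasurable_open[OF assms(2,1)] G(1) H(1) by (rule jet_norm_sq_lincomb_le)
  then have "jet_norm_sq s \<Omega> (\<lambda>is x. a * G is x + b * H is x)
      < ennreal (2 * a\<^sup>2 * c + 2 * b\<^sup>2 * d + \<eta>)"
  proof (rule order.strict_trans1)
    have "ennreal (2 * a\<^sup>2) * jet_norm_sq s \<Omega> G + ennreal (2 * b\<^sup>2) * jet_norm_sq s \<Omega> H
        \<le> ennreal (2 * a\<^sup>2) * ennreal c + ennreal (2 * b\<^sup>2) * ennreal d"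
      using G(2) H(2) by (intro add_mono mult_left_mono) auto
    also have "\<dots> = ennreal (2 * a\<^sup>2 * c + 2 * b\<^sup>2 * d)"
      using assms(3,4) by (simp flip: ennreal_mult ennreal_plus)
    also have "\<dots> < ennreal (2 * a\<^sup>2 * c + 2 * b\<^sup>2 * d + \<eta>)"
      using assms(3-5) by (intro ennreal_lessI) (auto intro: add_nonneg_pos)
    finally show "ennreal (2 * a\<^sup>2) * jet_norm_sq s \<Omega> G + ennreal (2 * b\<^sup>2) * jet_norm_sq s \<Omega> H
        < ennreal (2 * a\<^sup>2 * c + 2 * b\<^sup>2 * d + \<eta>)" .
  qed
  ultimately show ?thesis by (auto simp: sobolev_norm_sq_less_iff)
qed

section \<open>Linearity of H^s and H^s_0\<close>

lemma Hs_lincomb: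
  assumes "open \<Omega>" "bounded \<Omega>" "u \<in> Hs s \<Omega>" "v \<in> Hs s \<Omega>"
  shows "(\<lambda>x. a * u x + b * v x) \<in> Hs s \<Omega>"
proof -
  have fin: "\<exists>c>0. x < ennreal c" if "x < \<infinity>" for x
  proof (cases x)
    case (real r)
    then show ?thesis by (intro exI[of _ "r + 1"]) (auto simp: ennreal_lessI)
  qed (use that in auto)
  obtain c d where cd: "0 < c" "0 < d"
    "sobolev_norm_sq s \<Omega> u < ennreal c" "sobolev_norm_sq s \<Omega> v < ennreal d"
    using assms fin unfolding Hs_def by blast
  from sobolev_norm_sq_lincomb_less[OF assms(1,2) cd(1,2) zero_less_one cd(3,4), of a b]
  show ?thesis
    unfolding Hs_def by (simp add: order.strict_trans[OF _ ennreal_less_top])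
qed

lemma Hs0_lincomb:
  assumes "open \<Omega>" "bounded \<Omega>" "u \<in> Hs0 s \<Omega>" "v \<in> Hs0 s \<Omega>"
  shows "(\<lambda>x. a * u x + b * v x) \<in> Hs0 s \<Omega>"
proof -
  have "\<exists>\<psi>\<in>test_funs \<Omega>. sobolev_norm_sq s \<Omega> (\<lambda>x. a * u x + b * v x - \<psi> x) < ennreal (\<epsilon>\<^sup>2)"
    if \<epsilon>: "\<epsilon> > 0" for \<epsilon> :: real
  proof -
    \<comment> \<open>Approximating both functions within \<open>\<delta>\<close> and taking the
      slack to be \<open>2 * \<delta>\<^sup>2\<close> gives the total
      \<open>D * \<delta>\<^sup>2\<close>; the summand 1 keeps \<open>D\<close> positive for
      \<open>a = b = 0\<close>.\<close>
    define D where "D = 2 * (1 + a\<^sup>2 + b\<^sup>2)"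
    have D: "D > 0" by (simp add: D_def add_pos_nonneg)
    define \<delta> where "\<delta> = \<epsilon> / sqrt D"
    have \<delta>: "\<delta> > 0" "\<delta>\<^sup>2 = \<epsilon>\<^sup>2 / D" using D \<epsilon> by (simp_all add: \<delta>_def power_divide)
    obtain \<psi> \<xi> where \<psi>: "\<psi> \<in> test_funs \<Omega>" "sobolev_norm_sq s \<Omega> (\<lambda>x. u x - \<psi> x) < ennreal (\<delta>\<^sup>2)"
      and \<xi>: "\<xi> \<in> test_funs \<Omega>" "sobolev_norm_sq s \<Omega> (\<lambda>x. v x - \<xi> x) < ennreal (\<delta>\<^sup>2)"
      using assms(3,4) \<delta>(1) unfolding Hs0_def by blast
    have pos: "\<delta>\<^sup>2 > 0" "2 * \<delta>\<^sup>2 > 0" using \<delta>(1) by auto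
    have "sobolev_norm_sq s \<Omega> (\<lambda>x. a * (u x - \<psi> x) + b * (v x - \<xi> x))
        < ennreal (2 * a\<^sup>2 * \<delta>\<^sup>2 + 2 * b\<^sup>2 * \<delta>\<^sup>2 + 2 * \<delta>\<^sup>2)"
      using sobolev_norm_sq_lincomb_less[OF assms(1,2) pos(1) pos(1) pos(2) \<psi>(2) \<xi>(2)] .
    also have "2 * a\<^sup>2 * \<delta>\<^sup>2 + 2 * b\<^sup>2 * \<delta>\<^sup>2 + 2 * \<delta>\<^sup>2 = D * \<delta>\<^sup>2"
      by (simp add: D_def algebra_simps)
    also have "\<dots> = \<epsilon>\<^sup>2" using D \<delta>(2) by simp
    finally have "sobolev_norm_sq s \<Omega> (\<lambda>x. a * (u x - \<psi> x) + b * (v x - \<xi> x)) < ennreal (\<epsilon>\<^sup>2)" .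
    moreover have "(\<lambda>x. a * (u x - \<psi> x) + b * (v x - \<xi> x))
        = (\<lambda>x. a * u x + b * v x - (a * \<psi> x + b * \<xi> x))"
      by (auto simp: algebra_simps)
    ultimately show ?thesis
      using test_funs_lincomb[OF \<psi>(1) \<xi>(1), of a b] by auto
  qed
  then show ?thesis
    using Hs_lincomb[OF assms(1,2)] assms(3,4) unfolding Hs0_def by auto
qed

lemma Hs0_subset_L2: "Hs0 s \<Omega> \<subseteq> L2 \<Omega>"
proof
  fix u assume "u \<in> Hs0 s \<Omega>"
  then obtain G where "G \<in> weak_jets (nat \<lfloor>s\<rfloor>) \<Omega> u"
    by (auto simp: Hs0_def Hs_def sobolev_norm_sq_less_iff)
  then have "has_weak_derivative \<Omega> [] u (G [])" by (auto simp: weak_jets_def)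
  then show "u \<in> L2 \<Omega>" by (simp add: has_weak_derivative_def)
qed

text \<open>Starting at \<open>N = 1\<close> makes every sum a combination of members of the family;
  smaller spans are reached by monotonicity in \<open>N\<close>.\<close>

lemma sum_in_Hs0:
  fixes N :: nat
  assumes "open \<Omega>" "bounded \<Omega>" "\<And>i. i \<ge> 1 \<Longrightarrow> \<phi> i \<in> Hs0 s \<Omega>" "N \<ge> 1"
  shows "(\<lambda>x. \<Sum>i=1..N. c i * \<phi> i x) \<in> Hs0 s \<Omega>"
  using assms(4)
proof (induction N rule: dec_induct)
  case base
  show ?case
    using Hs0_lincomb[OF assms(1,2) assms(3)[of 1] assms(3)[of 1], of "c 1" 0] by simp
next
  case (step N)
  then show ?case
    using Hs0_lincomb[OF assms(1,2) step.IH assms(3)[of "Suc N"], of 1 "c (Suc N)"] by simp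
qed

section \<open>The spans\<close>

lemma fun_span_mono: "mono (fun_span \<phi>)"
proof (rule monoI)
  fix N M :: nat assume "N \<le> M"
  show "fun_span \<phi> N \<subseteq> fun_span \<phi> M"
  proof
    fix u assume "u \<in> fun_span \<phi> N"
    then obtain c where u: "u = (\<lambda>x. \<Sum>i=1..N. c i * \<phi> i x)" by (auto simp: fun_span_def)
    have "u = (\<lambda>x. \<Sum>i=1..M. (if i \<le> N then c i else 0) * \<phi> i x)"
      unfolding u using \<open>N \<le> M\<close> by (intro ext sum.mono_neutral_cong_left) auto
    then show "u \<in> fun_span \<phi> M" unfolding fun_span_def by auto
  qed
qed

lemma fun_span_uminus: "u \<in> fun_span \<phi> N \<Longrightarrow> (\<lambda>x. - u x) \<in> fun_span \<phi> N"
proof -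
  assume "u \<in> fun_span \<phi> N"
  then obtain c where "u = (\<lambda>x. \<Sum>i=1..N. c i * \<phi> i x)" by (auto simp: fun_span_def)
  then have "(\<lambda>x. - u x) = (\<lambda>x. \<Sum>i=1..N. (- c i) * \<phi> i x)" by (simp add: sum_negf)
  then show ?thesis unfolding fun_span_def by (auto intro!: exI[of _ "\<lambda>i. - c i"])
qed

section \<open>The energy norm\<close>

text \<open>A chosen eigenbasis lies in H^1_0, and the default alternative of
  \<open>dirichlet_spectrum\<close> is the zero function.\<close>

lemma eigfun_L2: "eigfun \<Omega> k \<in> L2 \<Omega>"
proof (cases "\<exists>p. dirichlet_eigenbasis \<Omega> p")
  case True
  then have "dirichlet_eigenbasis \<Omega> (dirichlet_spectrum \<Omega>)"
    unfolding dirichlet_spectrum_def by (auto intro: someI)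
  then have "eigfun \<Omega> k \<in> Hs0 1 \<Omega>"
    by (auto simp: dirichlet_eigenbasis_def dirichlet_eigenfunction_def eigfun_def split: prod.splits)
  then show ?thesis using Hs0_subset_L2 by blast
next
  case False
  then show ?thesis by (simp add: eigfun_def dirichlet_spectrum_def L2_def)
qed

text \<open>Young's inequality in each coefficient. With \<open>t = \<epsilon> / \<parallel>u\<parallel>\<close> and \<open>\<parallel>w\<parallel> \<le> \<epsilon>\<close> the right-hand side
  is at most \<open>(\<parallel>u\<parallel> + \<epsilon>)\<^sup>2\<close>, so this replaces the triangle inequality.\<close>

lemma frac_energy_diff_le:
  assumes "u \<in> L2 \<Omega>" "w \<in> L2 \<Omega>" "t > 0"
  shows "frac_energy s \<Omega> (\<lambda>x. u x - w x)
    \<le> ennreal (1 + t) * frac_energy s \<Omega> u + ennreal (1 + 1 / t) * frac_energy s \<Omega> w"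
proof -
  let ?e = "eigfun \<Omega>" and ?r = "\<lambda>k. eigval \<Omega> k powr s"
  let ?q = "\<lambda>u k. ennreal (L2_inner \<Omega> u (?e k) * frac_laplacian_coeff s \<Omega> u k)"
  have "?q (\<lambda>x. u x - w x) k \<le> ennreal (1 + t) * ?q u k + ennreal (1 + 1 / t) * ?q w k" for k
  proof -
    let ?x = "L2_inner \<Omega> u (?e k)" and ?y = "L2_inner \<Omega> w (?e k)"
    have diff: "L2_inner \<Omega> (\<lambda>x. u x - w x) (?e k) = ?x - ?y"
      using L2_inner_lincomb[OF assms(1,2) eigfun_L2, of 1 "-1"] by simp
    have "0 \<le> (t * ?x + ?y)\<^sup>2 / t" using assms(3) by simp
    also have "\<dots> = t * ?x\<^sup>2 + 2 * ?x * ?y + ?y\<^sup>2 / t"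
      using assms(3) by (simp add: power2_eq_square field_simps)
    finally have "(?x - ?y)\<^sup>2 \<le> (1 + t) * ?x\<^sup>2 + (1 + 1 / t) * ?y\<^sup>2"
      by (simp add: power2_diff algebra_simps)
    \<comment> \<open>\<open>powr\<close> is nonnegative for every real base, so the weights
      preserve the inequality whatever the signs of the eigenvalues.\<close>
    then have "?r k * (?x - ?y)\<^sup>2 \<le> ?r k * ((1 + t) * ?x\<^sup>2 + (1 + 1 / t) * ?y\<^sup>2)"
      by (intro mult_left_mono) auto
    then have "(?x - ?y) * (?r k * (?x - ?y))
        \<le> (1 + t) * (?x * (?r k * ?x)) + (1 + 1 / t) * (?y * (?r k * ?y))"
      by (simp add: power2_eq_square algebra_simps)
    moreover have "0 \<le> z * (?r k * z)" for z
      using mult_nonneg_nonneg[of "?r k" "z * z"] by (simp add: mult.left_commute)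
    ultimately show ?thesis
      unfolding frac_laplacian_coeff_def diff
      using assms(3) by (simp flip: ennreal_mult ennreal_plus)
  qed
  then have "frac_energy s \<Omega> (\<lambda>x. u x - w x)
      \<le> (\<Sum>k. ennreal (1 + t) * ?q u k + ennreal (1 + 1 / t) * ?q w k)"
    unfolding frac_energy_def by (intro suminf_le) auto
  also have "\<dots> = ennreal (1 + t) * frac_energy s \<Omega> u + ennreal (1 + 1 / t) * frac_energy s \<Omega> w"
    unfolding frac_energy_def by (subst suminf_add[symmetric]) auto
  finally show ?thesis .
qed

lemma Hs0_norm_nonneg: "0 \<le> Hs0_norm s \<Omega> u"
  by (simp add: Hs0_norm_def)

text \<open>Moves between the extended norm and the energy without case distinctions: infinite
  energy falsifies both sides.\<close>

lemma Hs0_norm_le_iff: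
  assumes "0 \<le> r"
  shows "Hs0_norm s \<Omega> u \<le> ereal r \<longleftrightarrow> frac_energy s \<Omega> u \<le> ennreal (r\<^sup>2)"
proof (cases "frac_energy s \<Omega> u")
  case (real q)
  then show ?thesis
    using assms by (simp add: Hs0_norm_def) (metis real_sqrt_le_iff real_sqrt_unique)
qed (auto simp: Hs0_norm_def top_unique)

text \<open>Phrased with positive upper bounds instead of the norms themselves, so that
  \<open>\<epsilon> / a\<close> is a valid Young parameter even if a norm vanishes.\<close>

lemma Hs0_norm_diff_le:
  assumes "u \<in> L2 \<Omega>" "w \<in> L2 \<Omega>" "0 < a" "0 < \<epsilon>"
    and "Hs0_norm s \<Omega> u \<le> ereal a" "Hs0_norm s \<Omega> w \<le> ereal \<epsilon>"
  shows "Hs0_norm s \<Omega> (\<lambda>x. u x - w x) \<le> ereal (a + \<epsilon>)"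
proof -
  have "frac_energy s \<Omega> (\<lambda>x. u x - w x)
      \<le> ennreal (1 + \<epsilon> / a) * frac_energy s \<Omega> u + ennreal (1 + 1 / (\<epsilon> / a)) * frac_energy s \<Omega> w"
    using assms by (intro frac_energy_diff_le) auto
  also have "\<dots> \<le> ennreal (1 + \<epsilon> / a) * ennreal (a\<^sup>2) + ennreal (1 + 1 / (\<epsilon> / a)) * ennreal (\<epsilon>\<^sup>2)"
    using assms by (intro add_mono mult_left_mono) (auto simp: Hs0_norm_le_iff)
  also have "\<dots> = ennreal ((1 + \<epsilon> / a) * a\<^sup>2 + (1 + 1 / (\<epsilon> / a)) * \<epsilon>\<^sup>2)"
    using assms by (simp flip: ennreal_mult ennreal_plus)
  also have "(1 + \<epsilon> / a) * a\<^sup>2 + (1 + 1 / (\<epsilon> / a)) * \<epsilon>\<^sup>2 = (a + \<epsilon>)\<^sup>2"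
    using assms by (simp add: power2_eq_square field_simps)
  finally show ?thesis using assms by (simp add: Hs0_norm_le_iff)
qed

lemma Hs0_norm_uminus: "Hs0_norm s \<Omega> (\<lambda>x. - u x) = Hs0_norm s \<Omega> u"
  by (simp add: Hs0_norm_def frac_energy_def frac_laplacian_coeff_def L2_inner_def)

lemma Hs0_norm_ae_zero:
  assumes "ae_zero \<Omega> u"
  shows "Hs0_norm s \<Omega> u = 0"
proof -
  have "L2_inner \<Omega> u v = 0" for v
    unfolding L2_inner_def using assms
    by (intro integral_eq_zero_AE) (auto simp: ae_zero_def)
  then show ?thesis by (simp add: Hs0_norm_def frac_energy_def)
qed

section \<open>Dual seminorms\<close>

text \<open>For \<open>n = 0\<close> the bound by \<open>C\<close> forces \<open>y = 0\<close>, and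
  0 / 0 is 0 in \<open>ereal\<close>. For \<open>n = \<infinity>\<close> the quotient is 0 because
  \<open>y\<close> is finite, hence at most \<open>K\<close>.\<close>

lemma dual_quotient_le_iff:
  assumes "ereal \<bar>y\<bar> \<le> ereal C * n" "0 \<le> n" "0 \<le> K"
  shows "ereal y / n \<le> K \<longleftrightarrow> n = \<infinity> \<or> ereal y \<le> K * n"
proof (cases n)
  case (real r)
  show ?thesis
  proof (cases "r = 0")
    case True
    then have "y = 0" using assms real by simp
    then show ?thesis using True real assms(3) by (simp add: zero_ereal_def[symmetric])
  next
    case False
    then have "r > 0" using assms(2) real by simp
    then show ?thesis
      using real assms(3) by (cases K) (auto simp: divide_le_eq)
  qed
qed (use assms in auto)

text \<open>One of the quotients at \<open>u\<close> and \<open>-u\<close> is nonnegative. The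
  non-null element matters: the supremum of the empty set is -\<infinity>.\<close>

lemma dual_seminorm_nonneg:
  assumes "u \<in> V" "(\<lambda>x. - u x) \<in> V" "\<not> ae_zero \<Omega> u" "f (\<lambda>x. - u x) = - f u"
  shows "0 \<le> dual_seminorm s \<Omega> V f"
proof -
  let ?q = "\<lambda>u. ereal (f u) / Hs0_norm s \<Omega> u"
  have "\<not> ae_zero \<Omega> (\<lambda>x. - u x)" using assms(3) by (simp add: ae_zero_def)
  then have "?q u \<le> dual_seminorm s \<Omega> V f" "?q (\<lambda>x. - u x) \<le> dual_seminorm s \<Omega> V f"
    unfolding dual_seminorm_def using assms(1-3)
    by (intro SUP_upper[where f="?q"]; simp)+
  moreover have "0 \<le> ?q u \<or> 0 \<le> ?q (\<lambda>x. - u x)"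
    using Hs0_norm_nonneg[of s \<Omega> u]
    by (cases "f u \<ge> 0") (auto simp: assms(4) Hs0_norm_uminus zero_le_divide_ereal)
  ultimately show ?thesis by (meson order_trans)
qed

text \<open>Stated for any dense set \<open>V\<close>; nonnegativity is a hypothesis because for the
  spans it comes from their symmetry.\<close>

lemma dual_seminorm_eq_of_dense:
  assumes dom: "open \<Omega>" "bounded \<Omega>" and f: "f \<in> Hs_dual s \<Omega>" and V: "V \<subseteq> Hs0 s \<Omega>"
    and dense: "Hs0_closure s \<Omega> V = Hs0 s \<Omega>" and nonneg: "0 \<le> dual_seminorm s \<Omega> V f"
  shows "dual_seminorm s \<Omega> V f = Hs_dual_norm s \<Omega> f"
proof (rule antisym)
  show "dual_seminorm s \<Omega> V f \<le> Hs_dual_norm s \<Omega> f"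
    unfolding Hs_dual_norm_def dual_seminorm_def using V by (intro SUP_subset_mono) auto
  define K where "K = dual_seminorm s \<Omega> V f"
  obtain C where C: "C \<ge> 0" "\<And>u. u \<in> Hs0 s \<Omega> \<Longrightarrow> ereal \<bar>f u\<bar> \<le> ereal C * Hs0_norm s \<Omega> u"
    using f by (auto simp: Hs_dual_def)
  have lin: "f (\<lambda>x. u x - v x) = f u - f v" if "u \<in> Hs0 s \<Omega>" "v \<in> Hs0 s \<Omega>" for u v
  proof -
    have "f (\<lambda>x. 1 * u x + (-1) * v x) = 1 * f u + (-1) * f v"
      using f that unfolding Hs_dual_def by blast
    then show ?thesis by simp
  qed
  have K: "0 \<le> K" using nonneg by (simp add: K_def)
  \<comment> \<open>At infinite norm the quotient is 0 and says nothing about \<open>f v\<close>,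
    while \<open>K * \<infinity>\<close> is 0 for \<open>K = 0\<close>; hence the restriction to
    finite norm.\<close>
  have fV: "ereal (f v) \<le> K * Hs0_norm s \<Omega> v" if v: "v \<in> V" "Hs0_norm s \<Omega> v \<noteq> \<infinity>" for v
  \<comment> \<open>Null functions are excluded from the supremum, but for them the norm, and by
    boundedness \<open>f v\<close>, is 0.\<close>
  proof (cases "ae_zero \<Omega> v")
    case True
    then have "Hs0_norm s \<Omega> v = 0" by (rule Hs0_norm_ae_zero)
    then show ?thesis using C(2)[of v] v(1) V by (auto simp flip: zero_ereal_def)
  next
    case False
    then have "ereal (f v) / Hs0_norm s \<Omega> v \<le> K"
      unfolding K_def dual_seminorm_def using v(1) by (auto intro!: SUP_upper)
    then show ?thesis
      using dual_quotient_le_iff[OF C(2)[of v] Hs0_norm_nonneg K] v V by auto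
  qed
  have "ereal (f u) / Hs0_norm s \<Omega> u \<le> K" if u: "u \<in> Hs0 s \<Omega>" for u
  proof (cases "Hs0_norm s \<Omega> u = \<infinity> \<or> K = \<infinity>")
    case True
    then show ?thesis using K by auto
  next
    case False
    then obtain a k where a: "Hs0_norm s \<Omega> u = ereal a" and k: "K = ereal k"
      using Hs0_norm_nonneg[of s \<Omega> u] K
      by (cases "Hs0_norm s \<Omega> u"; cases K) auto
    have a0: "0 \<le> a" using a Hs0_norm_nonneg[of s \<Omega> u] by auto
    have "f u \<le> k * a"
    \<comment> \<open>\<open>Hs0_norm_diff_le\<close> requires a positive bound; for
      \<open>a = 0\<close> boundedness of \<open>f\<close> alone gives
      \<open>f u = 0\<close>.\<close>
    proof (cases "a = 0")
      case True
      then show ?thesis using C(2)[OF u] a by (simp add: zero_ereal_def)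
    next
      case False
      then have pos: "0 < a" using a0 by simp
      have eps: "f u \<le> k * (a + \<epsilon>) + C * \<epsilon>" if \<epsilon>: "\<epsilon> > 0" for \<epsilon>
      proof -
        have "u \<in> Hs0_closure s \<Omega> V" using u dense by simp
        then obtain v where v: "v \<in> V" "Hs0_norm s \<Omega> (\<lambda>x. u x - v x) < ereal \<epsilon>"
          using \<epsilon> unfolding Hs0_closure_def by blast
        let ?w = "\<lambda>x. u x - v x"
        have vH: "v \<in> Hs0 s \<Omega>" using v(1) V by blast
        have w: "?w \<in> Hs0 s \<Omega>"
          using Hs0_lincomb[OF dom u vH, of 1 "-1"] by simp
        \<comment> \<open>Here \<open>v\<close> is written as \<open>u - (u - v)\<close>. The
          estimate also shows that its norm is finite, as \<open>fV\<close> requires.\<close>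
        have "Hs0_norm s \<Omega> (\<lambda>x. u x - ?w x) \<le> ereal (a + \<epsilon>)"
          using u w v(2) pos \<epsilon> a Hs0_subset_L2 by (intro Hs0_norm_diff_le) auto
        then have nv: "Hs0_norm s \<Omega> v \<le> ereal (a + \<epsilon>)" by simp
        have "ereal (f v) \<le> K * Hs0_norm s \<Omega> v"
          using v(1) nv by (intro fV) auto
        also have "\<dots> \<le> K * ereal (a + \<epsilon>)"
          using nv K by (rule ereal_mult_left_mono)
        finally have "f v \<le> k * (a + \<epsilon>)" by (simp add: k)
        moreover have "ereal \<bar>f ?w\<bar> \<le> ereal C * ereal \<epsilon>"
          using C(1) by (intro order_trans[OF C(2)[OF w] ereal_mult_left_mono[OF less_imp_le[OF v(2)]]]) simp
        then have "\<bar>f u - f v\<bar> \<le> C * \<epsilon>" using lin[OF u vH] by simp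
        ultimately show ?thesis by linarith
      qed
      have "((\<lambda>\<epsilon>. k * (a + \<epsilon>) + C * \<epsilon>) \<longlongrightarrow> k * (a + 0) + C * 0) (at_right 0)"
        by (intro tendsto_intros)
      then have "f u \<le> k * (a + 0) + C * 0"
        by (rule tendsto_lowerbound)
          (auto intro!: eventually_at_right_less[THEN eventually_mono] eps)
      then show ?thesis by simp
    qed
    then show ?thesis
      using dual_quotient_le_iff[OF C(2)[OF u] Hs0_norm_nonneg K] a k by simp
  qed
  then show "Hs_dual_norm s \<Omega> f \<le> dual_seminorm s \<Omega> V f"
    unfolding Hs_dual_norm_def dual_seminorm_def[of s \<Omega> "Hs0 s \<Omega>"] K_def[symmetric]
    by (auto intro!: SUP_least)
qed

section \<open>The limit along the spans\<close>

theorem proposition3p3: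
  fixes \<Omega> :: "(real^'n) set" and s :: real
    and \<phi> :: "nat \<Rightarrow> real^'n \<Rightarrow> real" and f :: "(real^'n \<Rightarrow> real) \<Rightarrow> real"
  assumes "lipschitz_domain \<Omega>" and "s > 0"
    and "\<And>i. i \<ge> 1 \<Longrightarrow> \<phi> i \<in> Hs0 s \<Omega>"
    and "lin_indep \<Omega> \<phi>"
    and "Hs0_closure s \<Omega> (\<Union>N. fun_span \<phi> N) = Hs0 s \<Omega>"
    and "f \<in> Hs_dual s \<Omega>"
  shows "(\<lambda>N. dual_seminorm s \<Omega> (fun_span \<phi> N) f) \<longlonglongrightarrow> Hs_dual_norm s \<Omega> f"
proof -
  let ?V = "\<Union>N. fun_span \<phi> N"
  have dom: "open \<Omega>" "bounded \<Omega>" using assms(1) by (auto simp: lipschitz_domain_def)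
  have V: "?V \<subseteq> Hs0 s \<Omega>"
  proof
    fix u assume "u \<in> ?V"
    then obtain N where "u \<in> fun_span \<phi> N" by blast
    \<comment> \<open>Enlarging the span meets the condition \<open>N \<ge> 1\<close> of
      \<open>sum_in_Hs0\<close> and so covers \<open>N = 0\<close>.\<close>
    then have "u \<in> fun_span \<phi> (Suc N)" using fun_span_mono[of \<phi>] by (auto dest: monoD[of _ N "Suc N"])
    then obtain c where "u = (\<lambda>x. \<Sum>i=1..Suc N. c i * \<phi> i x)" unfolding fun_span_def by blast
    then show "u \<in> Hs0 s \<Omega>"
      using sum_in_Hs0[of \<Omega> \<phi> s "Suc N" c] dom assms(3) by simp
  qed
  have \<phi>1: "\<phi> 1 \<in> fun_span \<phi> 1"
    unfolding fun_span_def by (auto intro!: exI[of _ "\<lambda>_. 1"])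
  \<comment> \<open>Linear independence enters here: it provides a non-null element of the
    union.\<close>
  have nz: "\<not> ae_zero \<Omega> (\<phi> 1)"
  proof
    assume "ae_zero \<Omega> (\<phi> 1)"
    then show False
      using assms(4)[unfolded lin_indep_def, rule_format, of "\<lambda>_. 1" 1 1] by simp
  qed
  have "f (\<lambda>x. (-1) * \<phi> 1 x + 0 * \<phi> 1 x) = (-1) * f (\<phi> 1) + 0 * f (\<phi> 1)"
    using assms(3)[of 1] assms(6) unfolding Hs_dual_def by blast
  then have "0 \<le> dual_seminorm s \<Omega> ?V f"
    using \<phi>1 fun_span_uminus[OF \<phi>1] nz by (intro dual_seminorm_nonneg[of "\<phi> 1"]) auto
  then have "dual_seminorm s \<Omega> ?V f = Hs_dual_norm s \<Omega> f"
    by (intro dual_seminorm_eq_of_dense dom assms V)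
  moreover have "dual_seminorm s \<Omega> ?V f = (SUP N. dual_seminorm s \<Omega> (fun_span \<phi> N) f)"
  proof -
    have "{u \<in> ?V. \<not> ae_zero \<Omega> u} = (\<Union>N. {u \<in> fun_span \<phi> N. \<not> ae_zero \<Omega> u})" by auto
    then show ?thesis unfolding dual_seminorm_def by (simp only: SUP_UNION)
  qed
  \<comment> \<open>For \<open>N = 0\<close> the span contains only the zero function, so the
    seminorm is -\<infinity>; monotonicity and the supremum are unaffected.\<close>
  moreover have "incseq (\<lambda>N. dual_seminorm s \<Omega> (fun_span \<phi> N) f)"
    unfolding dual_seminorm_def using fun_span_mono[of \<phi>]
    by (auto intro!: monoI SUP_subset_mono dest: monoD)
  ultimately show ?thesis by (metis LIMSEQ_SUP)
qed

end
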